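(* Let $t^*=(t_1^*,\dots,t_I^* )\in\{1,\dots,T\}^I$ be a given vector of revision times, and let $\{y_n^{TLP}\}_{n\in\mathcal T}$ be the optimal capacity allocation decisions of the linear programming relaxation of the two-stage version of the stochastic capacity expansion planning problem. Then $$V^{TS}-V^{ATS}(t^* )\ \ge\ \sum_{i=1}^{I}\Big(v_i^T-v_i^R(t_i^* )-\max_{n\in\hat{\mathcal T}_i(t_i^* )}\{\lceil\hat\delta_{in}\rceil-\hat\delta_{in}\}\,a_{i1}\Big),$$ where $v_i^T$ and $v_i^R(t_i^* )$ are the optimal values of the linear programming relaxations of the two-stage single-resource problem and of the adaptive two-stage single-resource problem with revision time $t_i^*$ for resource $i$, under $\delta_{in}=[A_ny_n^{TLP}]_i$.
   Context: $\mathcal T$ is a scenario tree with $T$ stages: a rooted tree (root denoted 1) whose nodes $n$ have period $t_n\in\{1,\dots,T\}$. $S_t$ is the set of nodes of period $t$; $P(n)$ is the set of nodes on the path from the root to $n$ (inclusive); $\mathcal T(n)$ is the subtree rooted at $n$. $p_n$ is the probability of (reaching) node $n$, with $\sum_{n\in S_t}p_n=1$ for each $t$. Multi-stage stochastic capacity expansion planning problem, with resources $\mathcal I$ ($I=|\mathcal I|$), tasks $\mathcal J$, items $\mathcal K$: $$\min\Big\{\sum_{n\in\mathcal T}p_n(a_n^\top x_n+b_n^\top y_n):\ A_ny_n\le\sum_{m\in P(n)}x_m,\ B_ny_n\ge d_n,\ x_n\in\mathbb Z_+^{|\mathcal I|},\ y_n\in\mathbb R_+^{|\mathcal J|}\ \forall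 n\in\mathcal T\Big\},$$ with $a_n\in\mathbb R_+^{|\mathcal I|}$, $b_n\in\mathbb R_+^{|\mathcal J|}$, $d_n\in\mathbb R_+^{|\mathcal K|}$; $x_n$ are capacity acquisition decisions and $y_n$ capacity allocation decisions. Two-stage version: add $x_{im}=x_{in}$ for all $m,n\in S_t$, all $t$, all $i$. Adaptive two-stage version with revision decisions $t^*$: add instead, for each $i$, $x_{im}=x_{in}$ for all $m,n\in S_t$, $t<t_i^*$, and $x_{im}=x_{in}$ for all $m,n\in S_t\cap\mathcal T(j)$, $j\in S_{t_i^*}$, $t\ge t_i^*$. $V^{TS}$ and $V^{ATS}(t^* )$ are the optimal values of the (mixed-integer) two-stage version and adaptive two-stage version with revision decisions $t^*$. Linear programming relaxations replace $\mathbb Z_+$ by $\mathbb R_+$. Single-resource problems for resource $i$ given $\{\delta_{in}\}_{n\in\mathcal T}$: minimize $\sum_{n\in\mathcal T}p_na_{in}x_{in}$ subject to $\sum_{m\in P(n)}x_{im}\ge\delta_{in}$, $x_{in}\in\mathbb Z_+$ for all $n\in\mathcal T$, together with the two-stage constraints for $i$ (two-stage) or the adaptive constraints for $i$ with $t_i^*$ (adaptive two-stage). Condensed tree: $\hat{\mathcal T}_i(t_i^* )$ is obtained from $\mathcal T$ by merging nodes forced to have equal $x_i$-decisions by the adaptive constraints: its nodes correspond to the sets $S_t$ for $t<t_i^*$, and $S_t\cap\mathcal T(j)$ for $j\in S_{t_i^*}$, $t\ge t_i^*$. If $\hat C_n\subset\mathcal T$ is the set merged into node $n\in\hat{\mathcal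 T}_i(t_i^* )$, then $\hat\delta_{in}=\max_{m\in\hat C_n}\delta_{im}$. $[\cdot]_i$ is the $i$-th component of a vector. *)

theory Defs
  imports "HOL-Analysis.Analysis"
begin

record 'v scenario_tree =
  nodes :: "'v set"
  root_node :: 'v
  parent :: "'v \<Rightarrow> 'v"    \<comment> \<open>irrelevant at the root\<close>
  num_stages :: nat
  period :: "'v \<Rightarrow> nat"
  prob :: "'v \<Rightarrow> real"

text \<open>
  Since periods are natural numbers that drop by one from a node to its parent, every node is
  connected to the root, so the parent map does describe a rooted tree, and the period of a node is
  its depth.
\<close>

locale scenario_tree =
  fixes \<T> :: "('v, 'z) scenario_tree_scheme" (structure)
  assumes finite_nodes: "finite (nodes \<T>)"
    and root_in_nodes: "root_node \<T> \<in> nodes \<T>"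
    and parent_in_nodes: "n \<in> nodes \<T> \<Longrightarrow> n \<noteq> root_node \<T> \<Longrightarrow> parent \<T> n \<in> nodes \<T>"
    and period_root: "period \<T> (root_node \<T>) = 1"
    and period_parent:
      "n \<in> nodes \<T> \<Longrightarrow> n \<noteq> root_node \<T> \<Longrightarrow> period \<T> n = period \<T> (parent \<T> n) + 1"
    and period_le: "n \<in> nodes \<T> \<Longrightarrow> period \<T> n \<le> num_stages \<T>"
    and prob_nonneg: "n \<in> nodes \<T> \<Longrightarrow> 0 \<le> prob \<T> n"
    and prob_stage:
      "t \<in> {1..num_stages \<T>} \<Longrightarrow> (\<Sum>n\<in>{n \<in> nodes \<T>. period \<T> n = t}. prob \<T> n) = 1"

definition stage :: "('v, 'z) scenario_tree_scheme \<Rightarrow> nat \<Rightarrow> 'v set" where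
  "stage \<T> t = {n \<in> nodes \<T>. period \<T> n = t}"

definition tree_edges :: "('v, 'z) scenario_tree_scheme \<Rightarrow> ('v \<times> 'v) set" where
  "tree_edges \<T> = {(parent \<T> n, n) | n. n \<in> nodes \<T> \<and> n \<noteq> root_node \<T>}"

definition root_path :: "('v, 'z) scenario_tree_scheme \<Rightarrow> 'v \<Rightarrow> 'v set" where
  "root_path \<T> n = {m \<in> nodes \<T>. (m, n) \<in> (tree_edges \<T>)\<^sup>*}"

definition subtree :: "('v, 'z) scenario_tree_scheme \<Rightarrow> 'v \<Rightarrow> 'v set" where
  "subtree \<T> j = {n \<in> nodes \<T>. j \<in> root_path \<T> n}"

definition two_stage :: "('v, 'z) scenario_tree_scheme \<Rightarrow> ('v \<Rightarrow> real) \<Rightarrow> bool" where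
  "two_stage \<T> z \<longleftrightarrow> (\<forall>t. \<forall>m \<in> stage \<T> t. \<forall>n \<in> stage \<T> t. z m = z n)"

definition adaptive_two_stage ::
    "('v, 'z) scenario_tree_scheme \<Rightarrow> nat \<Rightarrow> ('v \<Rightarrow> real) \<Rightarrow> bool" where
  "adaptive_two_stage \<T> s z \<longleftrightarrow>
     (\<forall>t < s. \<forall>m \<in> stage \<T> t. \<forall>n \<in> stage \<T> t. z m = z n) \<and>
     (\<forall>j \<in> stage \<T> s. \<forall>t \<ge> s.
        \<forall>m \<in> stage \<T> t \<inter> subtree \<T> j. \<forall>n \<in> stage \<T> t \<inter> subtree \<T> j. z m = z n)"

text \<open>
  A node of the condensed tree is represented by the set of nodes merged into it. Empty sets, which
  occur if a branch of the tree ends before the last stage, are not nodes.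
\<close>

definition condensed_nodes :: "('v, 'z) scenario_tree_scheme \<Rightarrow> nat \<Rightarrow> 'v set set" where
  "condensed_nodes \<T> s =
     ({stage \<T> t | t. 1 \<le> t \<and> t < s} \<union>
      {stage \<T> t \<inter> subtree \<T> j | t j. j \<in> stage \<T> s \<and> s \<le> t \<and> t \<le> num_stages \<T>}) - {{}}"

definition condensed_demand :: "('v \<Rightarrow> real) \<Rightarrow> 'v set \<Rightarrow> real" where
  "condensed_demand \<delta> C = Max (\<delta> ` C)"

text \<open>
  The types \<open>'i\<close>, \<open>'j\<close>, \<open>'k\<close> index resources, tasks and items. The order on vectors is
  componentwise.
\<close>

record ('v, 'i, 'j, 'k) expansion_problem = "'v scenario_tree" +
  acq_cost :: "'v \<Rightarrow> real ^ 'i"              \<comment> \<open>\<open>a\<^sub>n\<close>\<close>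
  alloc_cost :: "'v \<Rightarrow> real ^ 'j"            \<comment> \<open>\<open>b\<^sub>n\<close>\<close>
  resource_use :: "'v \<Rightarrow> real ^ 'j ^ 'i"     \<comment> \<open>\<open>A\<^sub>n\<close>\<close>
  item_output :: "'v \<Rightarrow> real ^ 'j ^ 'k"      \<comment> \<open>\<open>B\<^sub>n\<close>\<close>
  demand :: "'v \<Rightarrow> real ^ 'k"                \<comment> \<open>\<open>d\<^sub>n\<close>\<close>

locale expansion_problem = scenario_tree P
  for P :: "('v, 'i::finite, 'j::finite, 'k::finite) expansion_problem" (structure) +
  assumes acq_cost_nonneg: "n \<in> nodes P \<Longrightarrow> 0 \<le> acq_cost P n"
    and alloc_cost_nonneg: "n \<in> nodes P \<Longrightarrow> 0 \<le> alloc_cost P n"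
    and demand_nonneg: "n \<in> nodes P \<Longrightarrow> 0 \<le> demand P n"

text \<open>
  \<open>D\<close> is the domain of the acquisition decisions: \<open>\<nat>\<close> for the mixed-integer problems and
  \<open>{0..}\<close> for their linear programming relaxations. \<open>Q i\<close> is the two-stage or adaptive constraint
  on the acquisition decisions for resource \<open>i\<close>.
\<close>

definition feasible ::
    "('v, 'i::finite, 'j::finite, 'k::finite) expansion_problem \<Rightarrow> real set \<Rightarrow>
     ('i \<Rightarrow> ('v \<Rightarrow> real) \<Rightarrow> bool) \<Rightarrow> ('v \<Rightarrow> real ^ 'i) \<Rightarrow> ('v \<Rightarrow> real ^ 'j) \<Rightarrow> bool" where
  "feasible P D Q x y \<longleftrightarrow>
     (\<forall>n \<in> nodes P.
        resource_use P n *v y n \<le> (\<Sum>m \<in> root_path P n. x m) \<and>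
        item_output P n *v y n \<ge> demand P n \<and>
        (\<forall>i. x n $ i \<in> D) \<and> 0 \<le> y n) \<and>
     (\<forall>i. Q i (\<lambda>n. x n $ i))"

definition total_cost ::
    "('v, 'i::finite, 'j::finite, 'k::finite) expansion_problem \<Rightarrow>
     ('v \<Rightarrow> real ^ 'i) \<Rightarrow> ('v \<Rightarrow> real ^ 'j) \<Rightarrow> real" where
  "total_cost P x y =
     (\<Sum>n \<in> nodes P. prob P n * (acq_cost P n \<bullet> x n + alloc_cost P n \<bullet> y n))"

definition optimal_solution ::
    "('v, 'i::finite, 'j::finite, 'k::finite) expansion_problem \<Rightarrow> real set \<Rightarrow>
     ('i \<Rightarrow> ('v \<Rightarrow> real) \<Rightarrow> bool) \<Rightarrow> ('v \<Rightarrow> real ^ 'i) \<Rightarrow> ('v \<Rightarrow> real ^ 'j) \<Rightarrow> bool" where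
  "optimal_solution P D Q x y \<longleftrightarrow>
     feasible P D Q x y \<and>
     (\<forall>x' y'. feasible P D Q x' y' \<longrightarrow> total_cost P x y \<le> total_cost P x' y')"

text \<open>
  Optimal values are real infima. Costs are bounded below by zero because all data in the objective
  are nonnegative. For infeasible problems \<open>Inf {}\<close> carries no information, but as soon as the
  relaxed two-stage problem is feasible, all problems below are: the acquisitions at the root can be
  increased to large integers.
\<close>

definition optimal_value ::
    "('v, 'i::finite, 'j::finite, 'k::finite) expansion_problem \<Rightarrow> real set \<Rightarrow>
     ('i \<Rightarrow> ('v \<Rightarrow> real) \<Rightarrow> bool) \<Rightarrow> real" where
  "optimal_value P D Q = Inf {total_cost P x y | x y. feasible P D Q x y}"

definition V_TS :: "('v, 'i::finite, 'j::finite, 'k::finite) expansion_problem \<Rightarrow> real" where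
  "V_TS P = optimal_value P \<nat> (\<lambda>i. two_stage P)"

definition V_ATS ::
    "('v, 'i::finite, 'j::finite, 'k::finite) expansion_problem \<Rightarrow> ('i \<Rightarrow> nat) \<Rightarrow> real" where
  "V_ATS P ts = optimal_value P \<nat> (\<lambda>i. adaptive_two_stage P (ts i))"

definition single_resource_feasible ::
    "('v, 'z) scenario_tree_scheme \<Rightarrow> real set \<Rightarrow> (('v \<Rightarrow> real) \<Rightarrow> bool) \<Rightarrow>
     ('v \<Rightarrow> real) \<Rightarrow> ('v \<Rightarrow> real) \<Rightarrow> bool" where
  "single_resource_feasible \<T> D Q \<delta> z \<longleftrightarrow>
     (\<forall>n \<in> nodes \<T>. (\<Sum>m \<in> root_path \<T> n. z m) \<ge> \<delta> n \<and> z n \<in> D) \<and> Q z"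

definition single_resource_value ::
    "('v, 'z) scenario_tree_scheme \<Rightarrow> real set \<Rightarrow> (('v \<Rightarrow> real) \<Rightarrow> bool) \<Rightarrow>
     ('v \<Rightarrow> real) \<Rightarrow> ('v \<Rightarrow> real) \<Rightarrow> real" where
  "single_resource_value \<T> D Q c \<delta> =
     Inf {(\<Sum>n \<in> nodes \<T>. prob \<T> n * c n * z n) | z. single_resource_feasible \<T> D Q \<delta> z}"

definition v_T ::
    "('v, 'i::finite, 'j::finite, 'k::finite) expansion_problem \<Rightarrow> 'i \<Rightarrow> ('v \<Rightarrow> real) \<Rightarrow> real" where
  "v_T P i \<delta> = single_resource_value P {0..} (two_stage P) (\<lambda>n. acq_cost P n $ i) \<delta>"

definition v_R ::
    "('v, 'i::finite, 'j::finite, 'k::finite) expansion_problem \<Rightarrow> 'i \<Rightarrow> nat \<Rightarrow>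
     ('v \<Rightarrow> real) \<Rightarrow> real" where
  "v_R P i s \<delta> =
     single_resource_value P {0..} (adaptive_two_stage P s) (\<lambda>n. acq_cost P n $ i) \<delta>"

end

theory Submission
  imports Defs
begin

text \<open>
  Fixing the allocation \<open>y_TLP\<close> splits a problem into single-resource problems. The relaxed
  two-stage problem bounds \<open>V_TS\<close> from below, so \<open>V_TS\<close> is at least the allocation cost of \<open>y_TLP\<close>
  plus the sum of the \<open>v_T\<close>. Conversely, integral solutions of the adaptive single-resource problems
  combine with \<open>y_TLP\<close> to a solution of the adaptive problem, so \<open>V_ATS\<close> is at most the same
  allocation cost plus the sum of the integral adaptive single-resource values. The allocation costs
  cancel in the difference.

  What remains is the gap between the integral and the relaxed adaptive single-resource value, which
  is bounded in \<open>integral_value_le_relaxed_value\<close>. Let \<open>Z n\<close> be the capacity accumulated up to \<open>n\<close>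
  in a relaxed solution. The adaptive constraint makes \<open>Z\<close> constant on each condensed node, so \<open>Z\<close>
  dominates the condensed demand and not only \<open>\<delta>\<close>. Buying \<open>r\<close> more units at the root, where \<open>r\<close> is the
  largest rounding error of a condensed demand, therefore makes \<open>Z + r\<close> dominate the rounded-up
  demands, and costs \<open>r\<close> times the price at the root.

  The new solution now has integral right-hand sides and can be rounded at no cost. For a threshold
  \<open>\<theta> \<in> [0,1]\<close>, replace the accumulated capacity by \<open>\<lfloor>Z n + r + \<theta>\<rfloor>\<close>. This is integral, still
  increases along paths, is constant where \<open>Z\<close> is, and stays above the integral demands. The mean
  of \<open>\<lfloor>a + \<theta>\<rfloor>\<close> over \<open>\<theta>\<close> is \<open>a\<close>, and the cost is linear in the accumulated capacities, so the mean
  cost of the rounded solutions is the cost of the solution before rounding. The integral optimal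
  value does not exceed this mean.
\<close>

section \<open>Random threshold rounding\<close>

lemma floor_shift_has_integral:
  fixes a :: real
  shows "((\<lambda>\<theta>. of_int \<lfloor>a + \<theta>\<rfloor>) has_integral a) {0..1}"
proof -
  define k where "k = \<lfloor>a\<rfloor>"
  \<comment> \<open>the point at which the integrand jumps from \<open>k\<close> to \<open>k + 1\<close>\<close>
  define u where "u = of_int k + 1 - a"
  have k: "of_int k \<le> a" "a < of_int k + 1"
    unfolding k_def by linarith+
  have u: "0 \<le> u" "u \<le> 1"
    using k by (auto simp: u_def)
  have "((\<lambda>_. of_int k) has_integral (u - 0) * of_int k) {0..u}"
    using has_integral_const_real[of "of_int k :: real" 0 u] u by simp
  then have 1: "((\<lambda>\<theta>. of_int \<lfloor>a + \<theta>\<rfloor>) has_integral (u - 0) * of_int k) {0..u}"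
  proof (rule has_integral_spike_finite[of "{u}", rotated 2])
    fix \<theta> assume "\<theta> \<in> {0..u} - {u}"
    then have "\<lfloor>a + \<theta>\<rfloor> = k"
      using k by (intro floor_unique) (auto simp: u_def)
    then show "of_int \<lfloor>a + \<theta>\<rfloor> = (of_int k :: real)" by simp
  qed simp
  have "((\<lambda>_. of_int (k + 1)) has_integral (1 - u) * of_int (k + 1)) {u..1}"
    using has_integral_const_real[of "of_int (k + 1) :: real" u 1] u by simp
  then have 2: "((\<lambda>\<theta>. of_int \<lfloor>a + \<theta>\<rfloor>) has_integral (1 - u) * of_int (k + 1)) {u..1}"
  proof (rule has_integral_eq[rotated])
    fix \<theta> assume "\<theta> \<in> {u..1}"
    then have "\<lfloor>a + \<theta>\<rfloor> = k + 1"
      using k by (intro floor_unique) (auto simp: u_def)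
    then show "of_int (k + 1) = (of_int \<lfloor>a + \<theta>\<rfloor> :: real)" by simp
  qed
  have "(u - 0) * of_int k + (1 - u) * of_int (k + 1) = a"
    by (simp add: u_def algebra_simps)
  with has_integral_combine[OF u 1 2] show ?thesis by simp
qed

section \<open>Paths in a scenario tree\<close>

context scenario_tree
begin

lemma period_ge_1: "n \<in> nodes \<T> \<Longrightarrow> 1 \<le> period \<T> n"
  using period_root period_parent by (cases "n = root_node \<T>") auto

lemma period_eq_1_iff: "n \<in> nodes \<T> \<Longrightarrow> period \<T> n = 1 \<longleftrightarrow> n = root_node \<T>"
  using period_root period_parent[of n] period_ge_1[OF parent_in_nodes[of n]]
  by (cases "n = root_node \<T>") auto

lemma prob_root: "prob \<T> (root_node \<T>) = 1"
proof -
  have "{n \<in> nodes \<T>. period \<T> n = 1} = {root_node \<T>}"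
    using period_eq_1_iff root_in_nodes by auto
  moreover have "1 \<in> {1..num_stages \<T>}"
    using period_le[OF root_in_nodes] period_root by simp
  ultimately show ?thesis
    using prob_stage[of 1] by simp
qed

lemma node_induct [consumes 1, case_names root step]:
  assumes "n \<in> nodes \<T>"
    and "Q (root_node \<T>)"
    and "\<And>n. n \<in> nodes \<T> \<Longrightarrow> n \<noteq> root_node \<T> \<Longrightarrow> Q (parent \<T> n) \<Longrightarrow> Q n"
  shows "Q n"
  using assms(1)
proof (induction "period \<T> n" arbitrary: n rule: less_induct)
  case less
  show ?case
    using assms(2,3) less parent_in_nodes period_parent by (cases "n = root_node \<T>") auto
qed

lemma root_path_root: "root_path \<T> (root_node \<T>) = {root_node \<T>}"
proof -
  have "m = root_node \<T>" if "(m, root_node \<T>) \<in> (tree_edges \<T>)\<^sup>*" for m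
    using that by (cases rule: rtranclE) (auto simp: tree_edges_def)
  then show ?thesis
    using root_in_nodes by (auto simp: root_path_def)
qed

lemma root_path_step:
  assumes "n \<in> nodes \<T>" "n \<noteq> root_node \<T>"
  shows "root_path \<T> n = insert n (root_path \<T> (parent \<T> n))"
proof -
  have edge: "(k, n) \<in> tree_edges \<T> \<longleftrightarrow> k = parent \<T> n" for k
    using assms by (auto simp: tree_edges_def)
  have "(m, n) \<in> (tree_edges \<T>)\<^sup>* \<longleftrightarrow> m = n \<or> (m, parent \<T> n) \<in> (tree_edges \<T>)\<^sup>*" for m
    using edge by (metis rtrancl.rtrancl_refl rtrancl.rtrancl_into_rtrancl rtranclE)
  then show ?thesis
    using assms by (auto simp: root_path_def)
qed

lemma period_le_of_root_path:
  assumes "n \<in> nodes \<T>" "m \<in> root_path \<T> n"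
  shows "period \<T> m \<le> period \<T> n"
  using assms
proof (induction rule: node_induct)
  case root
  then show ?case by (simp add: root_path_root)
next
  case (step n)
  then show ?case using period_parent[of n] by (auto simp: root_path_step)
qed

lemma finite_root_path: "finite (root_path \<T> n)"
  using finite_nodes by (simp add: root_path_def)

lemma sum_root_path_step:
  fixes z :: "'v \<Rightarrow> real"
  assumes "n \<in> nodes \<T>" "n \<noteq> root_node \<T>"
  shows "sum z (root_path \<T> n) = sum z (root_path \<T> (parent \<T> n)) + z n"
proof -
  have "n \<notin> root_path \<T> (parent \<T> n)"
    using period_le_of_root_path[OF parent_in_nodes, of n n] period_parent[of n] assms by auto
  then show ?thesis
    using root_path_step[OF assms] finite_root_path by simp
qed

lemma subtree_parent:
  assumes "n \<in> subtree \<T> j" "n \<noteq> j"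
  shows "n \<noteq> root_node \<T>" "parent \<T> n \<in> subtree \<T> j"
proof -
  show "n \<noteq> root_node \<T>"
    using assms by (auto simp: subtree_def root_path_root)
  then show "parent \<T> n \<in> subtree \<T> j"
    using assms root_path_step[of n] parent_in_nodes[of n] by (auto simp: subtree_def)
qed

lemma period_subtree:
  assumes "n \<in> subtree \<T> j"
  shows "period \<T> j \<le> period \<T> n"
  using assms period_le_of_root_path by (auto simp: subtree_def)

lemma subtree_same_period:
  assumes "n \<in> subtree \<T> j" "period \<T> n = period \<T> j"
  shows "n = j"
proof (rule ccontr)
  assume "n \<noteq> j"
  then show False
    using subtree_parent[OF assms(1)] period_subtree[of "parent \<T> n" j] period_parent[of n] assms
    by (auto simp: subtree_def)
qed

lemma ancestor_at_period:
  assumes "n \<in> nodes \<T>" "1 \<le> s" "s \<le> period \<T> n"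
  shows "\<exists>j \<in> stage \<T> s. n \<in> subtree \<T> j"
  using assms
proof (induction rule: node_induct)
  case root
  then show ?case
    using period_root root_in_nodes by (auto simp: stage_def subtree_def root_path_root)
next
  case (step n)
  show ?case
  proof (cases "s = period \<T> n")
    case True
    then show ?thesis
      using step.hyps by (intro bexI[of _ n]) (auto simp: stage_def subtree_def root_path_step)
  next
    case False
    then obtain j where "j \<in> stage \<T> s" "parent \<T> n \<in> subtree \<T> j"
      using step period_parent[of n] by auto
    then show ?thesis
      using step.hyps by (auto simp: subtree_def root_path_step)
  qed
qed

section \<open>Nodes merged by the adaptive constraint\<close>

definition merged :: "nat \<Rightarrow> 'v \<Rightarrow> 'v \<Rightarrow> bool" where
  "merged s m n \<longleftrightarrow> m \<in> nodes \<T> \<and> n \<in> nodes \<T> \<and> period \<T> m = period \<T> n \<and>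
     (period \<T> m < s \<or> (\<exists>j \<in> stage \<T> s. m \<in> subtree \<T> j \<and> n \<in> subtree \<T> j))"

lemma adaptive_two_stage_iff:
  "adaptive_two_stage \<T> s z \<longleftrightarrow> (\<forall>m n. merged s m n \<longrightarrow> z m = z n)" (is "?L \<longleftrightarrow> ?R")
proof
  assume L: ?L
  show ?R
  proof (intro allI impI)
    fix m n assume mn: "merged s m n"
    then have st: "m \<in> stage \<T> (period \<T> m)" "n \<in> stage \<T> (period \<T> m)"
      by (auto simp: merged_def stage_def)
    show "z m = z n"
    proof (cases "period \<T> m < s")
      case True
      with L st show ?thesis unfolding adaptive_two_stage_def by blast
    next
      case False
      with mn obtain j where "j \<in> stage \<T> s" "m \<in> subtree \<T> j" "n \<in> subtree \<T> j"
        by (auto simp: merged_def)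
      moreover have "s \<le> period \<T> m" using False by simp
      ultimately show ?thesis
        using L st unfolding adaptive_two_stage_def by blast
    qed
  qed
next
  assume R: ?R
  have "merged s m n" if "m \<in> stage \<T> t" "n \<in> stage \<T> t" "t < s" for m n t
    using that by (simp add: merged_def stage_def)
  moreover have "merged s m n"
    if "j \<in> stage \<T> s" "m \<in> stage \<T> t \<inter> subtree \<T> j" "n \<in> stage \<T> t \<inter> subtree \<T> j" for j m n t
    using that by (auto simp: merged_def stage_def)
  ultimately show ?L
    using R unfolding adaptive_two_stage_def by blast
qed

lemma two_stage_imp_adaptive: "two_stage \<T> z \<Longrightarrow> adaptive_two_stage \<T> s z"
  unfolding two_stage_def adaptive_two_stage_def by blast

text \<open>
  Merged nodes have merged ancestors, which is why the condensed structure is again a tree. The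
  alternative \<open>m = n\<close> covers the root, which has no parent.
\<close>

lemma merged_parent:
  assumes "merged s m n"
  shows "m = n \<or> m \<noteq> root_node \<T> \<and> n \<noteq> root_node \<T> \<and> merged s (parent \<T> m) (parent \<T> n)"
proof (cases "m = n")
  case False
  have mn: "m \<in> nodes \<T>" "n \<in> nodes \<T>" "period \<T> m = period \<T> n"
    using assms by (auto simp: merged_def)
  have nr: "m \<noteq> root_node \<T>" "n \<noteq> root_node \<T>"
    using False mn period_eq_1_iff by metis+
  have par: "parent \<T> m \<in> nodes \<T>" "parent \<T> n \<in> nodes \<T>"
      "period \<T> (parent \<T> m) = period \<T> (parent \<T> n)" "period \<T> (parent \<T> m) < period \<T> m"
    using mn nr parent_in_nodes period_parent[of m] period_parent[of n] by auto
  have "merged s (parent \<T> m) (parent \<T> n)"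
  proof (cases "period \<T> m < s")
    case True
    with par show ?thesis by (auto simp: merged_def)
  next
    case ge: False
    with assms obtain j where j: "j \<in> stage \<T> s" "m \<in> subtree \<T> j" "n \<in> subtree \<T> j"
      by (auto simp: merged_def)
    have "m \<noteq> j" "n \<noteq> j"
      using False j mn subtree_same_period by metis+
    then have "parent \<T> m \<in> subtree \<T> j" "parent \<T> n \<in> subtree \<T> j"
      using j subtree_parent by auto
    with j(1) par show ?thesis
      unfolding merged_def by blast
  qed
  with nr show ?thesis by simp
qed simp

lemma adaptive_sum_root_path:
  fixes z :: "'v \<Rightarrow> real"
  assumes "adaptive_two_stage \<T> s z" "merged s m n"
  shows "sum z (root_path \<T> m) = sum z (root_path \<T> n)"
proof -
  have "m \<in> nodes \<T>" using assms by (auto simp: merged_def)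
  then show ?thesis using assms(2)
  proof (induction arbitrary: n rule: node_induct)
    case root
    then show ?case using merged_parent[of s "root_node \<T>" n] by auto
  next
    case (step m)
    show ?case
    proof (cases "m = n")
      case False
      then have "n \<noteq> root_node \<T>" "merged s (parent \<T> m) (parent \<T> n)"
        using merged_parent[OF step.prems] by auto
      moreover have "z m = z n"
        using assms(1) step.prems unfolding adaptive_two_stage_iff by blast
      moreover have "n \<in> nodes \<T>"
        using step.prems by (simp add: merged_def)
      ultimately show ?thesis
        using step by (simp add: sum_root_path_step)
    qed simp
  qed
qed

text \<open>
  The acquisitions that lead to given accumulated capacities \<open>W\<close>; there is no capacity before the
  root.
\<close>

definition increments :: "('v \<Rightarrow> real) \<Rightarrow> 'v \<Rightarrow> real" where
  "increments W n = (if n = root_node \<T> then W n else W n - W (parent \<T> n))"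

lemma sum_increments:
  assumes "n \<in> nodes \<T>"
  shows "sum (increments W) (root_path \<T> n) = W n"
  using assms
  by (induction rule: node_induct)
    (auto simp: root_path_root sum_root_path_step, auto simp: increments_def)

lemma adaptive_increments:
  assumes "\<And>m n. merged s m n \<Longrightarrow> W m = W n"
  shows "adaptive_two_stage \<T> s (increments W)"
  unfolding adaptive_two_stage_iff
proof (intro allI impI)
  fix m n assume "merged s m n"
  then show "increments W m = increments W n"
    using merged_parent[of s m n] assms[of m n] assms[of "parent \<T> m" "parent \<T> n"]
    by (auto simp: increments_def)
qed

section \<open>Rounding error of the condensed demands\<close>

definition rounding_error :: "nat \<Rightarrow> ('v \<Rightarrow> real) \<Rightarrow> real" where
  "rounding_error s \<delta> =
     Max ((\<lambda>C. of_int \<lceil>condensed_demand \<delta> C\<rceil> - condensed_demand \<delta> C) ` condensed_nodes \<T> s)"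

lemma condensed_node_of_node:
  assumes "n \<in> nodes \<T>" "1 \<le> s"
  obtains C where "C \<in> condensed_nodes \<T> s" "n \<in> C" "\<And>m. m \<in> C \<Longrightarrow> merged s m n"
proof (cases "period \<T> n < s")
  case True
  have "n \<in> stage \<T> (period \<T> n)"
    using assms by (simp add: stage_def)
  moreover have "stage \<T> (period \<T> n) \<in> condensed_nodes \<T> s"
    using True period_ge_1[OF assms(1)] calculation by (auto simp: condensed_nodes_def)
  moreover have "merged s m n" if "m \<in> stage \<T> (period \<T> n)" for m
    using that True assms by (auto simp: merged_def stage_def)
  ultimately show ?thesis using that by blast
next
  case False
  then obtain j where j: "j \<in> stage \<T> s" "n \<in> subtree \<T> j"
    using ancestor_at_period[OF assms] by auto
  let ?C = "stage \<T> (period \<T> n) \<inter> subtree \<T> j"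
  have "n \<in> ?C"
    using assms j by (simp add: stage_def)
  moreover have "?C \<in> condensed_nodes \<T> s"
  proof -
    have "s \<le> period \<T> n" using False by simp
    with j(1) \<open>n \<in> ?C\<close> period_le[OF assms(1)] show ?thesis
      unfolding condensed_nodes_def by blast
  qed
  moreover have "merged s m n" if "m \<in> ?C" for m
    using that j assms by (auto simp: merged_def stage_def)
  ultimately show ?thesis using that by blast
qed

lemma condensed_nodes_subset: "condensed_nodes \<T> s \<subseteq> Pow (nodes \<T>)"
  by (auto simp: condensed_nodes_def stage_def)

lemma finite_condensed_nodes: "finite (condensed_nodes \<T> s)"
  using condensed_nodes_subset finite_nodes by (meson finite_Pow_iff finite_subset)

lemma rounding_error_ge:
  assumes "C \<in> condensed_nodes \<T> s"
  shows "of_int \<lceil>condensed_demand \<delta> C\<rceil> - condensed_demand \<delta> C \<le> rounding_error s \<delta>"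
  unfolding rounding_error_def using assms finite_condensed_nodes by (intro Max_ge) auto

lemma rounding_error_nonneg:
  assumes "1 \<le> s"
  shows "0 \<le> rounding_error s \<delta>"
proof -
  obtain C where "C \<in> condensed_nodes \<T> s"
    using condensed_node_of_node[OF root_in_nodes assms] by metis
  from rounding_error_ge[OF this, of \<delta>] show ?thesis by linarith
qed

text \<open>
  An adaptive solution accumulates the same capacity at all nodes of a condensed node, in particular
  at the one with the largest demand.
\<close>

lemma ceiling_demand_le:
  assumes "1 \<le> s" "adaptive_two_stage \<T> s z"
    and cover: "\<And>n. n \<in> nodes \<T> \<Longrightarrow> \<delta> n \<le> sum z (root_path \<T> n)"
    and n: "n \<in> nodes \<T>"
  shows "of_int \<lceil>\<delta> n\<rceil> \<le> sum z (root_path \<T> n) + rounding_error s \<delta>"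
proof -
  obtain C where C: "C \<in> condensed_nodes \<T> s" "n \<in> C" "\<And>m. m \<in> C \<Longrightarrow> merged s m n"
    using condensed_node_of_node[OF n assms(1)] by metis
  have fin: "finite C" "C \<subseteq> nodes \<T>"
    using C(1) condensed_nodes_subset finite_nodes finite_subset by blast+
  have "\<delta> m \<le> sum z (root_path \<T> n)" if "m \<in> C" for m
    using cover[of m] fin adaptive_sum_root_path[OF assms(2) C(3)] that by auto
  then have "condensed_demand \<delta> C \<le> sum z (root_path \<T> n)"
    unfolding condensed_demand_def using fin C(2) by (subst Max_le_iff) auto
  moreover have "\<delta> n \<le> condensed_demand \<delta> C"
    unfolding condensed_demand_def using fin C(2) by (intro Max_ge) auto
  then have "\<lceil>\<delta> n\<rceil> \<le> \<lceil>condensed_demand \<delta> C\<rceil>"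
    by (rule ceiling_mono)
  ultimately show ?thesis
    using rounding_error_ge[OF C(1), of \<delta>] by linarith
qed

section \<open>Integrality gap of the single-resource problem\<close>

lemma single_resource_value_le:
  assumes "single_resource_feasible \<T> D Q \<delta> z" "D \<subseteq> {0..}"
    and "\<And>n. n \<in> nodes \<T> \<Longrightarrow> 0 \<le> c n"
  shows "single_resource_value \<T> D Q c \<delta> \<le> (\<Sum>n \<in> nodes \<T>. prob \<T> n * c n * z n)"
  unfolding single_resource_value_def
proof (rule cInf_lower)
  show "bdd_below {\<Sum>n\<in>nodes \<T>. prob \<T> n * c n * z n |z. single_resource_feasible \<T> D Q \<delta> z}"
    using assms(2,3) prob_nonneg unfolding single_resource_feasible_def
    by (intro bdd_belowI[of _ 0]) (auto intro!: sum_nonneg mult_nonneg_nonneg)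
qed (use assms in auto)

text \<open>
  Here \<open>r\<close> units are bought at the root in addition to \<open>z\<close>. The bound holds because the right-hand
  side is the mean cost of the rounded solutions over all thresholds.
\<close>

lemma integral_value_le_raised_cost:
  fixes z :: "'v \<Rightarrow> real"
  assumes adaptive: "adaptive_two_stage \<T> s z"
    and nonneg: "\<And>n. n \<in> nodes \<T> \<Longrightarrow> 0 \<le> z n" "0 \<le> r"
    and cover: "\<And>n. n \<in> nodes \<T> \<Longrightarrow> of_int \<lceil>\<delta> n\<rceil> \<le> sum z (root_path \<T> n) + r"
    and cost: "\<And>n. n \<in> nodes \<T> \<Longrightarrow> 0 \<le> c n"
  shows "single_resource_value \<T> \<nat> (adaptive_two_stage \<T> s) c \<delta> \<le>
    (\<Sum>n \<in> nodes \<T>. prob \<T> n * c n * z n) + r * c (root_node \<T>)" (is "?v \<le> ?M")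
proof -
  define Z where "Z n = sum z (root_path \<T> n) + r" for n
  define W where "W \<theta> n = (of_int \<lfloor>Z n + \<theta>\<rfloor> :: real)" for \<theta> n
  let ?cost = "\<lambda>\<theta>. \<Sum>n \<in> nodes \<T>. prob \<T> n * c n * increments (W \<theta>) n"
  have Z_parent: "Z n = Z (parent \<T> n) + z n" if "n \<in> nodes \<T>" "n \<noteq> root_node \<T>" for n
    using sum_root_path_step[OF that] by (simp add: Z_def)
  have feasible: "single_resource_feasible \<T> \<nat> (adaptive_two_stage \<T> s) \<delta> (increments (W \<theta>))"
    if "\<theta> \<in> {0..1}" for \<theta>
    unfolding single_resource_feasible_def
  proof (intro conjI ballI)
    show "adaptive_two_stage \<T> s (increments (W \<theta>))"
    proof (rule adaptive_increments)
      fix m n assume "merged s m n"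
      then show "W \<theta> m = W \<theta> n"
        using adaptive_sum_root_path[OF adaptive, of m n] by (simp add: W_def Z_def)
    qed
    fix n assume n: "n \<in> nodes \<T>"
    have "\<lceil>\<delta> n\<rceil> \<le> \<lfloor>Z n + \<theta>\<rfloor>"
      using cover[OF n] that by (simp add: le_floor_iff Z_def)
    then have "\<delta> n \<le> W \<theta> n"
      unfolding W_def by linarith
    then show "\<delta> n \<le> sum (increments (W \<theta>)) (root_path \<T> n)"
      using sum_increments[OF n] by simp
    show "increments (W \<theta>) n \<in> \<nat>"
    proof (cases "n = root_node \<T>")
      case True
      then have "0 \<le> \<lfloor>Z n + \<theta>\<rfloor>"
        using nonneg n that by (simp add: Z_def root_path_root)
      then show ?thesis
        using True by (simp add: increments_def W_def Nats_altdef2)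
    next
      case False
      then have "\<lfloor>Z (parent \<T> n) + \<theta>\<rfloor> \<le> \<lfloor>Z n + \<theta>\<rfloor>"
        using Z_parent[OF n] nonneg n by (intro floor_mono) simp
      then show ?thesis
        using False by (simp add: increments_def W_def Nats_altdef2)
    qed
  qed
  have "((\<lambda>\<theta>. increments (W \<theta>) n) has_integral increments Z n) {0..1}" for n
    unfolding increments_def W_def
    by (cases "n = root_node \<T>") (auto intro!: has_integral_diff floor_shift_has_integral)
  then have mean: "(?cost has_integral (\<Sum>n \<in> nodes \<T>. prob \<T> n * c n * increments Z n)) {0..1}"
    by (intro has_integral_sum finite_nodes has_integral_mult_right)
  have "increments Z n = z n + (if n = root_node \<T> then r else 0)" if "n \<in> nodes \<T>" for n
    using that Z_parent by (auto simp: increments_def Z_def root_path_root)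
  then have "(\<Sum>n \<in> nodes \<T>. prob \<T> n * c n * increments Z n) =
      (\<Sum>n \<in> nodes \<T>. prob \<T> n * c n * z n +
        (if n = root_node \<T> then prob \<T> n * c n * r else 0))"
    by (intro sum.cong) (auto simp: algebra_simps)
  also have "\<dots> = ?M"
    using finite_nodes root_in_nodes prob_root by (simp add: sum.distrib)
  finally have total: "(?cost has_integral ?M) {0..1}"
    using mean by simp
  have const: "((\<lambda>_. ?v) has_integral ?v) {0..1::real}"
    using has_integral_const_real[of ?v "0::real" 1] by simp
  have "?v \<le> ?cost \<theta>" if "\<theta> \<in> {0..1}" for \<theta>
  proof (rule single_resource_value_le[OF feasible[OF that]])
    show "\<nat> \<subseteq> {0 :: real..}" by (auto simp: Nats_altdef2)
  qed (rule cost)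
  with const total show ?thesis
    by (rule has_integral_le)
qed

lemma integral_value_le_relaxed_value:
  assumes "1 \<le> s"
    and "single_resource_feasible \<T> {0..} (adaptive_two_stage \<T> s) \<delta> z"
    and "\<And>n. n \<in> nodes \<T> \<Longrightarrow> 0 \<le> c n"
  shows "single_resource_value \<T> \<nat> (adaptive_two_stage \<T> s) c \<delta> \<le>
    single_resource_value \<T> {0..} (adaptive_two_stage \<T> s) c \<delta>
      + rounding_error s \<delta> * c (root_node \<T>)" (is "?v \<le> ?w + ?e")
proof -
  have "?v - ?e \<le> ?w"
    unfolding single_resource_value_def[of _ "{0..}"]
  proof (rule cInf_greatest)
    show "{\<Sum>n\<in>nodes \<T>. prob \<T> n * c n * z n |z.
        single_resource_feasible \<T> {0..} (adaptive_two_stage \<T> s) \<delta> z} \<noteq> {}"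
      using assms(2) by blast
  next
    fix x assume "x \<in> {\<Sum>n\<in>nodes \<T>. prob \<T> n * c n * z n |z.
        single_resource_feasible \<T> {0..} (adaptive_two_stage \<T> s) \<delta> z}"
    then obtain z where x: "x = (\<Sum>n\<in>nodes \<T>. prob \<T> n * c n * z n)"
      and z: "single_resource_feasible \<T> {0..} (adaptive_two_stage \<T> s) \<delta> z"
      by blast
    have "?v \<le> x + ?e"
      unfolding x using z assms rounding_error_nonneg ceiling_demand_le[of s z \<delta>]
      by (intro integral_value_le_raised_cost) (auto simp: single_resource_feasible_def)
    then show "?v - ?e \<le> x" by simp
  qed
  then show ?thesis by simp
qed

end

section \<open>Splitting the expansion problem into its resources\<close>

text \<open>
  The elements of the sets \<open>X i\<close> are chosen independently, so the infimum of their sums is the sum of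
  the infima.
\<close>

lemma sum_Inf_ge:
  fixes X :: "'i::finite \<Rightarrow> real set"
  assumes ne: "\<And>i. X i \<noteq> {}"
    and le: "\<And>x. (\<And>i. x i \<in> X i) \<Longrightarrow> v \<le> b + (\<Sum>i\<in>UNIV. x i)"
  shows "v \<le> b + (\<Sum>i\<in>UNIV. Inf (X i))"
proof (rule field_le_epsilon)
  fix e :: real assume e: "0 < e"
  define d where "d = e / real CARD('i)"
  have "0 < d" using e by (simp add: d_def)
  have "\<exists>x. x \<in> X i \<and> x < Inf (X i) + d" for i
    using cInf_lessD[OF ne, of i "Inf (X i) + d"] \<open>0 < d\<close> by auto
  then obtain x where x: "\<And>i. x i \<in> X i" "\<And>i. x i < Inf (X i) + d"
    by metis
  have "v \<le> b + (\<Sum>i\<in>UNIV. x i)" using le x by blast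
  also have "(\<Sum>i\<in>UNIV. x i) \<le> (\<Sum>i\<in>UNIV. Inf (X i) + d)"
    using x(2) by (intro sum_mono) (simp add: less_imp_le)
  also have "\<dots> = (\<Sum>i\<in>UNIV. Inf (X i)) + e"
    by (simp add: sum.distrib d_def)
  finally show "v \<le> b + (\<Sum>i\<in>UNIV. Inf (X i)) + e" by simp
qed

context expansion_problem
begin

definition allocation_cost :: "('v \<Rightarrow> real ^ 'j) \<Rightarrow> real" where
  "allocation_cost y = (\<Sum>n \<in> nodes P. prob P n * (alloc_cost P n \<bullet> y n))"

definition acquisition_cost :: "'i \<Rightarrow> ('v \<Rightarrow> real) \<Rightarrow> real" where
  "acquisition_cost i z = (\<Sum>n \<in> nodes P. prob P n * (acq_cost P n $ i) * z n)"

lemma total_cost_split: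
  "total_cost P x y = allocation_cost y + (\<Sum>i\<in>UNIV. acquisition_cost i (\<lambda>n. x n $ i))"
proof -
  have "(\<Sum>i\<in>UNIV. acquisition_cost i (\<lambda>n. x n $ i)) =
      (\<Sum>n \<in> nodes P. \<Sum>i\<in>UNIV. prob P n * (acq_cost P n $ i) * (x n $ i))"
    unfolding acquisition_cost_def by (rule sum.swap)
  also have "\<dots> = (\<Sum>n \<in> nodes P. prob P n * (acq_cost P n \<bullet> x n))"
    by (simp add: inner_vec_def sum_distrib_left mult.assoc)
  finally show ?thesis
    by (simp add: total_cost_def allocation_cost_def sum.distrib algebra_simps)
qed

lemma feasible_iff_single_resource:
  assumes "\<And>i n. \<delta> i n = (resource_use P n *v y n) $ i"
  shows "feasible P D Q x y \<longleftrightarrow>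
     (\<forall>n \<in> nodes P. item_output P n *v y n \<ge> demand P n \<and> 0 \<le> y n) \<and>
     (\<forall>i. single_resource_feasible P D (Q i) (\<delta> i) (\<lambda>n. x n $ i))"
  unfolding feasible_def single_resource_feasible_def
  by (auto simp: less_eq_vec_def assms)

lemma acq_cost_component_nonneg: "n \<in> nodes P \<Longrightarrow> 0 \<le> acq_cost P n $ i"
  using acq_cost_nonneg[of n] by (simp add: less_eq_vec_def)

lemma total_cost_nonneg:
  assumes "feasible P D Q x y" "D \<subseteq> {0..}"
  shows "0 \<le> total_cost P x y"
proof -
  have "0 \<le> acq_cost P n \<bullet> x n + alloc_cost P n \<bullet> y n" if n: "n \<in> nodes P" for n
  proof -
    have "0 \<le> x n $ i" "0 \<le> y n $ j" for i j
      using assms n by (auto simp: feasible_def less_eq_vec_def)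
    then show ?thesis
      using acq_cost_nonneg[OF n] alloc_cost_nonneg[OF n]
      by (auto simp: less_eq_vec_def inner_vec_def intro!: add_nonneg_nonneg sum_nonneg)
  qed
  then show ?thesis
    using prob_nonneg by (auto simp: total_cost_def intro!: sum_nonneg)
qed

lemma optimal_value_le:
  assumes "feasible P D Q x y" "D \<subseteq> {0..}"
  shows "optimal_value P D Q \<le> total_cost P x y"
  unfolding optimal_value_def
proof (rule cInf_lower)
  show "bdd_below {total_cost P x y |x y. feasible P D Q x y}"
    using total_cost_nonneg assms(2) by (intro bdd_belowI[of _ 0]) auto
qed (use assms(1) in auto)

text \<open>
  Rounding up every acquisition preserves the equalities between acquisitions, so the integral
  problems are feasible whenever the relaxed two-stage problem is.
\<close>

lemma ceiling_feasible:
  assumes "single_resource_feasible P {0..} (two_stage P) \<delta> z"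
  shows "single_resource_feasible P \<nat> (two_stage P) \<delta> (\<lambda>n. of_int \<lceil>z n\<rceil>)"
  unfolding single_resource_feasible_def
proof (intro conjI ballI)
  show "two_stage P (\<lambda>n. of_int \<lceil>z n\<rceil>)"
    using assms unfolding single_resource_feasible_def two_stage_def by metis
  fix n assume n: "n \<in> nodes P"
  have "\<delta> n \<le> sum z (root_path P n)"
    using assms n by (simp add: single_resource_feasible_def)
  also have "\<dots> \<le> (\<Sum>m \<in> root_path P n. of_int \<lceil>z m\<rceil>)"
    by (intro sum_mono) simp
  finally show "\<delta> n \<le> (\<Sum>m \<in> root_path P n. of_int \<lceil>z m\<rceil>)" .
  have "0 \<le> z n"
    using assms n by (auto simp: single_resource_feasible_def)
  then have "0 \<le> \<lceil>z n\<rceil>" by linarith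
  then show "of_int \<lceil>z n\<rceil> \<in> (\<nat> :: real set)"
    by (simp add: Nats_altdef2)
qed

lemma single_resource_feasible_adaptive:
  assumes "single_resource_feasible P D (two_stage P) \<delta> z"
  shows "single_resource_feasible P D (adaptive_two_stage P s) \<delta> z"
  using assms two_stage_imp_adaptive by (auto simp: single_resource_feasible_def)

text \<open>
  In an optimal relaxed solution the acquisitions for each resource are one candidate for the
  single-resource problem that defines \<open>v_T\<close>, and the relaxed optimum bounds \<open>V_TS\<close> from below.
\<close>

lemma V_TS_ge:
  assumes opt: "optimal_solution P {0..} (\<lambda>i. two_stage P) x y"
    and \<delta>: "\<And>i n. \<delta> i n = (resource_use P n *v y n) $ i"
  shows "allocation_cost y + (\<Sum>i\<in>UNIV. v_T P i (\<delta> i)) \<le> V_TS P"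
proof -
  have feas: "feasible P {0..} (\<lambda>i. two_stage P) x y"
    and least: "\<And>x' y'. feasible P {0..} (\<lambda>i. two_stage P) x' y' \<Longrightarrow>
      total_cost P x y \<le> total_cost P x' y'"
    using opt by (auto simp: optimal_solution_def)
  have single: "single_resource_feasible P {0..} (two_stage P) (\<delta> i) (\<lambda>n. x n $ i)" for i
    using feas by (simp add: feasible_iff_single_resource[OF \<delta>])
  have "v_T P i (\<delta> i) \<le> acquisition_cost i (\<lambda>n. x n $ i)" for i
    unfolding v_T_def acquisition_cost_def
    using single_resource_value_le[OF single, of "\<lambda>n. acq_cost P n $ i"] acq_cost_component_nonneg
    by simp
  then have "allocation_cost y + (\<Sum>i\<in>UNIV. v_T P i (\<delta> i)) \<le> total_cost P x y"
    by (simp add: total_cost_split sum_mono)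
  also have "\<dots> \<le> V_TS P"
    unfolding V_TS_def optimal_value_def
  proof (rule cInf_greatest)
    have "feasible P \<nat> (\<lambda>i. two_stage P) (\<lambda>n. \<chi> i. of_int \<lceil>x n $ i\<rceil>) y"
      using feas by (simp add: feasible_iff_single_resource[OF \<delta>] ceiling_feasible)
    then show "{total_cost P x y |x y. feasible P \<nat> (\<lambda>i. two_stage P) x y} \<noteq> {}"
      by blast
  next
    fix w assume "w \<in> {total_cost P x y |x y. feasible P \<nat> (\<lambda>i. two_stage P) x y}"
    then obtain x' y' where w: "w = total_cost P x' y'" "feasible P \<nat> (\<lambda>i. two_stage P) x' y'"
      by blast
    then have "feasible P {0..} (\<lambda>i. two_stage P) x' y'"
      unfolding feasible_def by (auto simp: Nats_altdef2)
    with least w show "total_cost P x y \<le> w" by simp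
  qed
  finally show ?thesis .
qed

text \<open>
  For fixed allocations the resources do not interact, so any integral single-resource solutions
  combine to a solution of the whole problem.
\<close>

lemma V_ATS_le:
  assumes feas: "feasible P {0..} (\<lambda>i. two_stage P) x y"
    and \<delta>: "\<And>i n. \<delta> i n = (resource_use P n *v y n) $ i"
  shows "V_ATS P ts \<le> allocation_cost y + (\<Sum>i\<in>UNIV.
    single_resource_value P \<nat> (adaptive_two_stage P (ts i)) (\<lambda>n. acq_cost P n $ i) (\<delta> i))"
  unfolding single_resource_value_def
proof (rule sum_Inf_ge)
  fix i
  have "single_resource_feasible P {0..} (two_stage P) (\<delta> i) (\<lambda>n. x n $ i)"
    using feas by (simp add: feasible_iff_single_resource[OF \<delta>])
  then show "{\<Sum>n\<in>nodes P. prob P n * acq_cost P n $ i * z n |z.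
      single_resource_feasible P \<nat> (adaptive_two_stage P (ts i)) (\<delta> i) z} \<noteq> {}"
    using ceiling_feasible single_resource_feasible_adaptive by blast
next
  fix w :: "'i \<Rightarrow> real"
  assume "\<And>i. w i \<in> {\<Sum>n\<in>nodes P. prob P n * acq_cost P n $ i * z n |z.
      single_resource_feasible P \<nat> (adaptive_two_stage P (ts i)) (\<delta> i) z}"
  then have "\<forall>i. \<exists>z. w i = acquisition_cost i z \<and>
      single_resource_feasible P \<nat> (adaptive_two_stage P (ts i)) (\<delta> i) z"
    unfolding acquisition_cost_def by blast
  then obtain z where z: "\<And>i. w i = acquisition_cost i (z i)"
      "\<And>i. single_resource_feasible P \<nat> (adaptive_two_stage P (ts i)) (\<delta> i) (z i)"
    by metis
  have "feasible P \<nat> (\<lambda>i. adaptive_two_stage P (ts i)) (\<lambda>n. \<chi> i. z i n) y"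
    using feas z(2) by (simp add: feasible_iff_single_resource[OF \<delta>])
  then have "V_ATS P ts \<le> total_cost P (\<lambda>n. \<chi> i. z i n) y"
    unfolding V_ATS_def by (rule optimal_value_le) (auto simp: Nats_altdef2)
  then show "V_ATS P ts \<le> allocation_cost y + (\<Sum>i\<in>UNIV. w i)"
    by (simp add: total_cost_split z(1))
qed

end

theorem proposition6:
  fixes P :: "('v, 'i::finite, 'j::finite, 'k::finite) expansion_problem"
    and ts :: "'i \<Rightarrow> nat"
    and x_TLP :: "'v \<Rightarrow> real ^ 'i"
    and y_TLP :: "'v \<Rightarrow> real ^ 'j"
    and \<delta> :: "'i \<Rightarrow> 'v \<Rightarrow> real"
  assumes "expansion_problem P"
    and "\<And>i. ts i \<in> {1..num_stages P}"
    and "optimal_solution P {0..} (\<lambda>i. two_stage P) x_TLP y_TLP"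
    and "\<And>i n. \<delta> i n = (resource_use P n *v y_TLP n) $ i"
  shows "V_TS P - V_ATS P ts \<ge>
    (\<Sum>i\<in>UNIV. v_T P i (\<delta> i) - v_R P i (ts i) (\<delta> i)
       - Max ((\<lambda>C. of_int \<lceil>condensed_demand (\<delta> i) C\<rceil> - condensed_demand (\<delta> i) C)
              ` condensed_nodes P (ts i))
         * acq_cost P (root_node P) $ i)"
proof -
  interpret expansion_problem P by fact
  have feas: "feasible P {0..} (\<lambda>i. two_stage P) x_TLP y_TLP"
    using assms(3) by (simp add: optimal_solution_def)
  let ?w = "\<lambda>i. single_resource_value P \<nat> (adaptive_two_stage P (ts i)) (\<lambda>n. acq_cost P n $ i) (\<delta> i)"
  let ?e = "\<lambda>i. rounding_error (ts i) (\<delta> i) * acq_cost P (root_node P) $ i"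
  have "?w i \<le> v_R P i (ts i) (\<delta> i) + ?e i" for i
    unfolding v_R_def
  proof (rule integral_value_le_relaxed_value)
    show "1 \<le> ts i" using assms(2)[of i] by simp
    show "single_resource_feasible P {0..} (adaptive_two_stage P (ts i)) (\<delta> i) (\<lambda>n. x_TLP n $ i)"
      using feas by (simp add: feasible_iff_single_resource[OF assms(4)] single_resource_feasible_adaptive)
  qed (rule acq_cost_component_nonneg)
  then have "(\<Sum>i\<in>UNIV. ?w i) \<le> (\<Sum>i\<in>UNIV. v_R P i (ts i) (\<delta> i) + ?e i)"
    by (intro sum_mono)
  then have "(\<Sum>i\<in>UNIV. v_T P i (\<delta> i) - v_R P i (ts i) (\<delta> i) - ?e i) \<le> V_TS P - V_ATS P ts"
    using V_TS_ge[OF assms(3,4)] V_ATS_le[OF feas assms(4), of ts]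
    by (simp add: sum_subtractf sum.distrib)
  then show ?thesis
    by (simp add: rounding_error_def)
qed

end
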